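(* Let $\mathrm{MESP}(C,s)$ be an arbitrary MESP instance ($C$ an $n\times n$ real symmetric positive-semidefinite matrix, $0<s<n$ an integer, $\operatorname{rank}(C)\ge s$), let $\lambda_{\max}$ be the greatest eigenvalue of $C$, and let $C=\Phi\Lambda\Phi^\top$ be any real Schur decomposition of $C$. Then $\mathcal{M}(\mathcal{D}(\mathrm{MESP}(C,s);\Phi))$ is precisely $\mathrm{MESP}(\frac{1}{\lambda_{\max}}C,\,s)$.
   Context: $\mathrm{MESP}(C,s)$ is the problem of maximizing $\operatorname{ldet}(C_{S,S})$ over $S\subset\{1,\dots,n\}$ with $|S|=s$ ($\operatorname{ldet}$ = natural log of the determinant). $\text{D-Opt}(A,B,t)$, for $A\in\mathbb{R}^{n\times m}$, $B\in\mathbb{R}^{q\times m}$, is the problem of maximizing $\operatorname{ldet}(A_{T\cdot}^\top A_{T\cdot}+B^\top B)$ over $T\subset\{1,\dots,n\}$ with $|T|=t$, where $A_{T\cdot}$ consists of the rows of $A$ indexed by $T$. Two instances are the same if their data coincide. A real Schur decomposition of a symmetric $C$ is $C=\Phi\Lambda\Phi^\top$ with $\Phi$ orthogonal and $\Lambda$ diagonal. Map $\mathcal{D}$: $\mathcal{D}(\mathrm{MESP}(C,s);\Phi):=\text{D-Opt}(A,B,n-s)$ with $A:=\Phi(I_n-\frac{1}{\lambda_{\max}}\Lambda)^{1/2}$ and $B:=\frac{1}{\sqrt{\lambda_{\max}}}\Lambda^{1/2}$. Map $\mathcal{M}$: $\mathcal{M}(\text{D-Opt}(A,B,t)):=\mathrm{MESP}(I_n-A(A^\top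 A+B^\top B)^{-1}A^\top,\ n-t)$. *)

theory Defs
  imports
    "HOL-Library.Extended_Real"
    "Jordan_Normal_Form.Gauss_Jordan_Elimination"
    "Jordan_Normal_Form.DL_Rank"
    "Jordan_Normal_Form.DL_Submatrix"
    "Jordan_Normal_Form.Spectral_Radius"
begin

text \<open>An instance is its data; equality of instances is equality of the data, including the
  matrix dimensions. The order \<open>n\<close> is the number of rows of the first matrix, and index sets
  are subsets of \<open>{0..<n}\<close>.\<close>

datatype mesp = MESP "real mat" nat

datatype dopt = DOpt "real mat" "real mat" nat

definition ldet :: "real mat \<Rightarrow> ereal" where
  "ldet M = (if det M > 0 then ereal (ln (det M)) else -\<infinity>)"

fun mesp_value :: "mesp \<Rightarrow> ereal" where
  "mesp_value (MESP C s) =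
     (SUP S \<in> {S. S \<subseteq> {0..<dim_row C} \<and> card S = s}. ldet (submatrix C S S))"

fun dopt_value :: "dopt \<Rightarrow> ereal" where
  "dopt_value (DOpt A B t) =
     (SUP T \<in> {T. T \<subseteq> {0..<dim_row A} \<and> card T = t}.
        ldet (transpose_mat (submatrix A T UNIV) * submatrix A T UNIV + transpose_mat B * B))"

definition psd_mat :: "nat \<Rightarrow> real mat \<Rightarrow> bool" where
  "psd_mat n C \<longleftrightarrow> C \<in> carrier_mat n n \<and> transpose_mat C = C \<and>
     (\<forall>v \<in> carrier_vec n. 0 \<le> v \<bullet> (C *\<^sub>v v))"

definition mesp_instance :: "nat \<Rightarrow> mesp \<Rightarrow> bool" where
  "mesp_instance n P \<longleftrightarrow> (case P of MESP C s \<Rightarrow>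
     psd_mat n C \<and> 0 < s \<and> s < n \<and> s \<le> vec_space.rank n C)"

definition lambda_max :: "real mat \<Rightarrow> real" where
  "lambda_max C = Max (spectrum C)"

text \<open>The library's \<open>orthogonal_mat\<close> does not normalise the columns, so it is not used here.\<close>

definition real_schur_decomp :: "real mat \<Rightarrow> real mat \<Rightarrow> real mat \<Rightarrow> bool" where
  "real_schur_decomp C \<Phi> \<Lambda> \<longleftrightarrow> (let n = dim_row C in
     \<Phi> \<in> carrier_mat n n \<and> transpose_mat \<Phi> * \<Phi> = 1\<^sub>m n \<and> \<Phi> * transpose_mat \<Phi> = 1\<^sub>m n \<and>
     \<Lambda> \<in> carrier_mat n n \<and> diagonal_mat \<Lambda> \<and>
     C = \<Phi> * \<Lambda> * transpose_mat \<Phi>)"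

text \<open>The square root of a diagonal matrix with nonnegative diagonal entries.\<close>

definition diag_sqrt :: "real mat \<Rightarrow> real mat" where
  "diag_sqrt D = mat_diag (dim_row D) (\<lambda>i. sqrt (D $$ (i, i)))"

text \<open>The diagonal factor is determined by \<open>C\<close> and \<open>\<Phi>\<close>
  (it is \<open>\<Phi>\<^sup>T C \<Phi>\<close>), so it is not an argument of the map.\<close>

fun mesp_to_dopt :: "mesp \<Rightarrow> real mat \<Rightarrow> dopt" where
  "mesp_to_dopt (MESP C s) \<Phi> =
     (let n = dim_row C; lmax = lambda_max C; \<Lambda> = (THE \<Lambda>. real_schur_decomp C \<Phi> \<Lambda>) in
      DOpt (\<Phi> * diag_sqrt (1\<^sub>m n - (1 / lmax) \<cdot>\<^sub>m \<Lambda>))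
           ((1 / sqrt lmax) \<cdot>\<^sub>m diag_sqrt \<Lambda>)
           (n - s))"

text \<open>\<open>the (mat_inverse M)\<close> is the inverse of an invertible square matrix \<open>M\<close>; it is
  unspecified otherwise.\<close>

fun dopt_to_mesp :: "dopt \<Rightarrow> mesp" where
  "dopt_to_mesp (DOpt A B t) =
     (let n = dim_row A in
      MESP (1\<^sub>m n - A * the (mat_inverse (transpose_mat A * A + transpose_mat B * B)) * transpose_mat A)
           (n - t))"

end

theory Submission
  imports Defs
begin

text \<open>For the D-optimality data, \<open>A\<^sup>TA = I - \<Lambda>/\<lambda>\<^sub>m\<^sub>a\<^sub>x\<close> and
  \<open>B\<^sup>TB = \<Lambda>/\<lambda>\<^sub>m\<^sub>a\<^sub>x\<close> add up to the identity, so the inverse in the map back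
  disappears and \<open>I - AA\<^sup>T = C/\<lambda>\<^sub>m\<^sub>a\<^sub>x\<close>. Both square roots are genuine because
  the diagonal of \<open>\<Lambda>\<close> consists of eigenvalues of \<open>C\<close>, and \<open>\<lambda>\<^sub>m\<^sub>a\<^sub>x > 0\<close> because
  \<open>C\<close> has positive rank.\<close>

text \<open>Every column is the zero vector, which no independent set contains, so the empty set is
  a maximal independent set of columns.\<close>

lemma rank_zero_mat: "vec_space.rank n (0\<^sub>m n nc :: 'a::field mat) = 0"
proof -
  interpret vec_space "TYPE('a)" n .
  have cols: "set (cols (0\<^sub>m n nc :: 'a mat)) \<subseteq> {0\<^sub>v n}"
    by (auto simp: cols_def)
  have "T = {}" if "T \<subseteq> set (cols (0\<^sub>m n nc :: 'a mat))" "lin_indpt T" for T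
  proof -
    \<comment> \<open>Excluding the zero vector from an independent set uses that the scalars are
      nontrivial.\<close>
    have "(UNIV :: 'a set) \<noteq> {0}"
      by (metis UNIV_I singletonD zero_neq_one)
    moreover have "T \<subseteq> {0\<^sub>v n}"
      using that(1) cols by simp
    ultimately show ?thesis
      using that(2) zero_nin_lin_indpt[of T] by auto
  qed
  then have "maximal {} (\<lambda>T. T \<subseteq> set (cols (0\<^sub>m n nc :: 'a mat)) \<and> lin_indpt T)"
    by (auto simp: maximal_def lin_dep_def)
  then show ?thesis
    using rank_card_indpt[of "0\<^sub>m n nc :: 'a mat" nc "{}"] by simp
qed

lemma mat_inverse_one: "mat_inverse (1\<^sub>m n :: 'a::field mat) = Some (1\<^sub>m n)"
proof (cases "mat_inverse (1\<^sub>m n :: 'a mat)")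
  case None
  then have "(1\<^sub>m n :: 'a mat) \<notin> Units (ring_mat TYPE('a) n ())"
    by (rule mat_inverse(1)[OF one_carrier_mat])
  then show ?thesis
    by (auto simp: Units_def ring_mat_def)
next
  case (Some B)
  from mat_inverse(2)[OF one_carrier_mat this] have "B = 1\<^sub>m n"
    by (metis left_mult_one_mat)
  then show ?thesis
    using Some by simp
qed

lemma diagonal_mat_eq_mat_diag:
  assumes "D \<in> carrier_mat n n" "diagonal_mat D"
  shows "D = mat_diag n (\<lambda>i. D $$ (i, i))"
  using assms by (intro eq_matI) (auto simp: mat_diag_def diagonal_mat_def)

lemma transpose_mat_diag [simp]: "transpose_mat (mat_diag n f) = mat_diag n f"
  by (intro eq_matI) (auto simp: mat_diag_def)

context
  fixes n :: nat and C \<Phi> \<Lambda> :: "real mat"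
  assumes C: "C \<in> carrier_mat n n" and schur: "real_schur_decomp C \<Phi> \<Lambda>"
begin

lemma schur_facts:
  shows "\<Phi> \<in> carrier_mat n n" "\<Lambda> \<in> carrier_mat n n" "diagonal_mat \<Lambda>"
    and "transpose_mat \<Phi> * \<Phi> = 1\<^sub>m n" "\<Phi> * transpose_mat \<Phi> = 1\<^sub>m n"
    and "C = \<Phi> * \<Lambda> * transpose_mat \<Phi>"
  using schur C by (auto simp: real_schur_decomp_def Let_def)

lemma schur_mult_eq: "C * \<Phi> = \<Phi> * \<Lambda>"
proof -
  have "C * \<Phi> = \<Phi> * \<Lambda> * (transpose_mat \<Phi> * \<Phi>)"
    using schur_facts(1,2) unfolding schur_facts(6)
    by (simp add: assoc_mult_mat[of _ n n _ n _ n])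
  then show ?thesis
    using schur_facts(1,2,4) by simp
qed

text \<open>Since \<open>C\<close> and \<open>\<Phi>\<close> leave only one possible diagonal
  factor, the \<open>THE\<close> in \<open>mesp_to_dopt\<close> picks out the given
  \<open>\<Lambda>\<close>.\<close>

lemma schur_diagonal_eq: "\<Lambda> = transpose_mat \<Phi> * C * \<Phi>"
proof -
  have "transpose_mat \<Phi> * C * \<Phi> = transpose_mat \<Phi> * \<Phi> * \<Lambda>"
    using C schur_facts(1,2) schur_mult_eq
    by (simp add: assoc_mult_mat[of _ n n _ n _ n])
  then show ?thesis
    using schur_facts(2,4) by simp
qed

text \<open>Reading \<open>C * \<Phi> = \<Phi> * \<Lambda>\<close> column by column shows that the
  columns of \<open>\<Phi>\<close> are unit eigenvectors.\<close>

lemma schur_col: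
  assumes "i < n"
  shows "C *\<^sub>v col \<Phi> i = \<Lambda> $$ (i, i) \<cdot>\<^sub>v col \<Phi> i" "col \<Phi> i \<bullet> col \<Phi> i = 1"
proof -
  note facts = schur_facts(1,2)
  have "C *\<^sub>v col \<Phi> i = col (\<Phi> * \<Lambda>) i"
    using C facts assms schur_mult_eq col_mult2[of C n n \<Phi> n i] by simp
  also have "\<Phi> * \<Lambda> = mat n n (\<lambda>(k, j). \<Phi> $$ (k, j) * \<Lambda> $$ (j, j))"
    using mat_diag_mult_right[OF facts(1), of "\<lambda>j. \<Lambda> $$ (j, j)"]
      diagonal_mat_eq_mat_diag[OF facts(2) schur_facts(3)] by simp
  also have "col \<dots> i = \<Lambda> $$ (i, i) \<cdot>\<^sub>v col \<Phi> i"
    using facts assms by (intro eq_vecI) auto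
  finally show "C *\<^sub>v col \<Phi> i = \<Lambda> $$ (i, i) \<cdot>\<^sub>v col \<Phi> i" .
  have "(transpose_mat \<Phi> * \<Phi>) $$ (i, i) = col \<Phi> i \<bullet> col \<Phi> i"
    using facts assms by simp
  then show "col \<Phi> i \<bullet> col \<Phi> i = 1"
    using schur_facts(4) assms by simp
qed

text \<open>A column of \<open>\<Phi>\<close> has unit norm, hence is nonzero, so the entry lies in
  the spectrum. The spectrum is finite, so its \<open>Max\<close> is an upper bound.\<close>

lemma schur_entry_le_lambda_max:
  assumes "i < n"
  shows "\<Lambda> $$ (i, i) \<le> lambda_max C"
proof -
  have "col \<Phi> i \<noteq> 0\<^sub>v n" "col \<Phi> i \<in> carrier_vec n"
    using schur_col(2)[OF assms] schur_facts(1) assms by auto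
  then have "\<Lambda> $$ (i, i) \<in> spectrum C"
    using C schur_col(1)[OF assms]
    by (auto simp: spectrum_def eigenvalue_def eigenvector_def)
  then show ?thesis
    using card_finite_spectrum(1)[OF C] by (simp add: lambda_max_def)
qed

text \<open>The entry is the value of the quadratic form of \<open>C\<close> at a unit
  eigenvector.\<close>

lemma schur_entry_nonneg:
  assumes "psd_mat n C" "i < n"
  shows "0 \<le> \<Lambda> $$ (i, i)"
proof -
  have col: "col \<Phi> i \<in> carrier_vec n"
    using schur_facts(1) assms by auto
  then have "0 \<le> col \<Phi> i \<bullet> (C *\<^sub>v col \<Phi> i)"
    using assms by (auto simp: psd_mat_def)
  then show ?thesis
    using schur_col[OF assms(2)] col by simp
qed

text \<open>Otherwise every diagonal entry is squeezed between 0 and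
  \<open>lambda_max C \<le> 0\<close>, which forces \<open>\<Lambda> = 0\<close> and
  \<open>C = 0\<close>, of rank 0.\<close>

lemma lambda_max_pos:
  assumes "psd_mat n C" "0 < vec_space.rank n C"
  shows "0 < lambda_max C"
proof (rule ccontr)
  assume "\<not> 0 < lambda_max C"
  then have "\<Lambda> $$ (i, i) = 0" if "i < n" for i
    using schur_entry_le_lambda_max[OF that] schur_entry_nonneg[OF assms(1) that] by linarith
  then have "\<Lambda> = 0\<^sub>m n n"
    using schur_facts(2,3) by (intro eq_matI) (force simp: diagonal_mat_def)+
  then have "C = 0\<^sub>m n n"
    using schur_facts(1,6) by simp
  then show False
    using assms(2) by (simp add: rank_zero_mat)
qed

end

lemma the_schur_eq:
  assumes "real_schur_decomp C \<Phi> \<Lambda>" "C \<in> carrier_mat n n"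
  shows "(THE \<Lambda>. real_schur_decomp C \<Phi> \<Lambda>) = \<Lambda>"
  using assms schur_diagonal_eq by (intro the_equality) metis+

theorem theorem13:
  fixes n s :: nat and C \<Phi> \<Lambda> :: "real mat"
  assumes "mesp_instance n (MESP C s)"
    and "real_schur_decomp C \<Phi> \<Lambda>"
  shows "dopt_to_mesp (mesp_to_dopt (MESP C s) \<Phi>) = MESP ((1 / lambda_max C) \<cdot>\<^sub>m C) s"
proof -
  have psd: "psd_mat n C" and s: "0 < s" "s < n" "s \<le> vec_space.rank n C"
    using assms(1) by (auto simp: mesp_instance_def)
  then have C: "C \<in> carrier_mat n n"
    by (simp add: psd_mat_def)
  note schur = schur_facts[OF C assms(2)]
  let ?m = "lambda_max C" and ?l = "\<lambda>i. \<Lambda> $$ (i, i)"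
  have m: "0 < ?m"
    using lambda_max_pos[OF C assms(2) psd] s by simp
  define D where "D = diag_sqrt (1\<^sub>m n - (1 / ?m) \<cdot>\<^sub>m \<Lambda>)"
  define A where "A = \<Phi> * D"
  define B where "B = (1 / sqrt ?m) \<cdot>\<^sub>m diag_sqrt \<Lambda>"
  have \<Lambda>: "\<Lambda> = mat_diag n ?l"
    by (rule diagonal_mat_eq_mat_diag[OF schur(2,3)])
  have D_eq: "D = mat_diag n (\<lambda>i. sqrt (1 - ?l i / ?m))"
    using schur(2) by (intro eq_matI) (auto simp: D_def diag_sqrt_def mat_diag_def)
  have D: "D \<in> carrier_mat n n" "transpose_mat D = D"
    by (simp_all add: D_eq)
  \<comment> \<open>\<open>sqrt\<close> is odd on the reals, so squaring it gives an absolute value.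
    The bound \<open>?l i \<le> ?m\<close> makes \<open>1 - ?l i / ?m\<close> nonnegative and so
    removes that absolute value.\<close>
  have DD: "D * D = 1\<^sub>m n - (1 / ?m) \<cdot>\<^sub>m \<Lambda>"
  proof (subst \<Lambda>, rule eq_matI)
    fix i j assume "i < dim_row (1\<^sub>m n - (1 / ?m) \<cdot>\<^sub>m mat_diag n ?l)"
      "j < dim_col (1\<^sub>m n - (1 / ?m) \<cdot>\<^sub>m mat_diag n ?l)"
    then show "(D * D) $$ (i, j) = (1\<^sub>m n - (1 / ?m) \<cdot>\<^sub>m mat_diag n ?l) $$ (i, j)"
      using schur_entry_le_lambda_max[OF C assms(2), of i] m
      by (simp add: D_eq) (auto simp: mat_diag_def)
  qed (simp_all add: D_eq mat_diag_def)
  have A: "A \<in> carrier_mat n n"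
    using schur(1) D by (simp add: A_def)
  have At: "transpose_mat A = D * transpose_mat \<Phi>"
    using schur(1) D by (simp add: A_def transpose_mult[of _ n n _ n])
  have B_eq: "B = mat_diag n (\<lambda>i. sqrt (?l i / ?m))"
    using schur(2) by (intro eq_matI) (auto simp: B_def diag_sqrt_def mat_diag_def real_sqrt_divide)
  \<comment> \<open>Here the absolute value disappears because positive semidefiniteness gives
    \<open>0 \<le> ?l i\<close>.\<close>
  have BB: "transpose_mat B * B = (1 / ?m) \<cdot>\<^sub>m \<Lambda>"
  proof (subst \<Lambda>, rule eq_matI)
    fix i j assume "i < dim_row ((1 / ?m) \<cdot>\<^sub>m mat_diag n ?l)"
      "j < dim_col ((1 / ?m) \<cdot>\<^sub>m mat_diag n ?l)"
    then show "(transpose_mat B * B) $$ (i, j) = ((1 / ?m) \<cdot>\<^sub>m mat_diag n ?l) $$ (i, j)"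
      using schur_entry_nonneg[OF C assms(2) psd, of i] m
      by (simp add: B_eq) (auto simp: mat_diag_def)
  qed (simp_all add: B_eq mat_diag_def)
  have "transpose_mat A * A = D * (transpose_mat \<Phi> * \<Phi>) * D"
    using schur(1) D unfolding At by (simp add: A_def assoc_mult_mat[of _ n n _ n _ n])
  then have AtA: "transpose_mat A * A = 1\<^sub>m n - (1 / ?m) \<cdot>\<^sub>m \<Lambda>"
    using D DD by (simp add: schur(4))
  have "transpose_mat A * A + transpose_mat B * B = 1\<^sub>m n"
    unfolding AtA BB using schur(2) by (intro eq_matI) auto
  then have inv: "the (mat_inverse (transpose_mat A * A + transpose_mat B * B)) = 1\<^sub>m n"
    by (simp add: mat_inverse_one)
  have "A * transpose_mat A = \<Phi> * (D * D) * transpose_mat \<Phi>"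
    using schur(1) D unfolding At by (simp add: A_def assoc_mult_mat[of _ n n _ n _ n])
  \<comment> \<open>Conjugation by \<open>\<Phi>\<close> is distributed over the difference: the
    identity is preserved and \<open>\<Lambda>\<close> turns back into \<open>C\<close>.\<close>
  also have "\<dots> = (\<Phi> * 1\<^sub>m n - \<Phi> * ((1 / ?m) \<cdot>\<^sub>m \<Lambda>)) * transpose_mat \<Phi>"
    unfolding DD using schur(1,2) by (subst mult_minus_distrib_mat[of _ n n _ n]) auto
  also have "\<dots> = \<Phi> * 1\<^sub>m n * transpose_mat \<Phi> - \<Phi> * ((1 / ?m) \<cdot>\<^sub>m \<Lambda>) * transpose_mat \<Phi>"
    using schur(1,2) by (intro minus_mult_distrib_mat[of _ n n _ _ n]) auto
  also have "\<dots> = 1\<^sub>m n - (1 / ?m) \<cdot>\<^sub>m (\<Phi> * \<Lambda> * transpose_mat \<Phi>)"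
    using schur(1,2,5) by (simp add: mult_smult_distrib[of _ n n _ n] mult_smult_assoc_mat[of _ n n _ n])
  finally have AA: "A * transpose_mat A = 1\<^sub>m n - (1 / ?m) \<cdot>\<^sub>m C"
    using schur(6) by simp
  have "1\<^sub>m n - A * 1\<^sub>m n * transpose_mat A = (1 / ?m) \<cdot>\<^sub>m C"
    using A C AA by (intro eq_matI) auto
  moreover have "mesp_to_dopt (MESP C s) \<Phi> = DOpt A B (n - s)"
    using C by (simp add: the_schur_eq[OF assms(2) C] A_def B_def D_def Let_def)
  \<comment> \<open>The subset size is restored too: \<open>n - (n - s) = s\<close> in truncated
    subtraction because \<open>s < n\<close>.\<close>
  ultimately show ?thesis
    using A s inv by simp
qed

end
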